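(* Let $u^k$ be the $k$-th iterate of the FASD-ALS algorithm (fast subspace descent with approximate line search, described in the context) and $u^{k+1}=\text{FASD-ALS}(u^k)$. Suppose that the space decomposition $\mathcal V=\mathcal V_1+\cdots+\mathcal V_N$ is stable with constant $C_A$ and satisfies the strengthened Cauchy--Schwarz inequality with constant $C_S$, that $E$ is strongly convex with constant $\mu$ and has Lipschitz continuous derivative on $\mathcal B$ with constant $L$, and that each local energy $E_i$ is strongly convex with constant $\mu_i$ and has Lipschitz continuous derivative on $\mathcal B_i$ with constant $L_i$ (all in the sense given in the context). Let $u$ be the minimizer of $E$ over $\mathcal V$. Then $$E(u^{k+1})-E(u)\le\rho\,\bigl(E(u^k)-E(u)\bigr),\qquad \rho=\frac{C_A^2\left[C_S+L\left(1+\max_{1\le i\le N}\{L_i/\mu_i\}\right)\right]^2}{C_A^2\left[C_S+L\left(1+\max_{1\le i\le N}\{L_i/\mu_i\}\right)\right]^2+L\mu}.$$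
   Context: $\mathcal V$ is a real Hilbert space with norm $\|\cdot\|_{\mathcal V}$, dual $\mathcal V'$, duality pairing $\langle\cdot,\cdot\rangle$, and dual norm $\|f\|_{\mathcal V'}=\sup_{v\neq0}\langle f,v\rangle/\|v\|_{\mathcal V}$. $E:\mathcal V\to\mathbb R$ is Fréchet differentiable with derivative $E'(v)\in\mathcal V'$. A point $u_0\in\mathcal V$ is fixed, $\mathcal B=\{v\in\mathcal V: E(v)\le E(u_0)\}$, and the iteration starts from $u^0=u_0$. Strong convexity of $E$: there is $\mu>0$ with $\mu\|w-v\|_{\mathcal V}^2\le\langle E'(w)-E'(v),w-v\rangle$ for all $v,w\in\mathcal V$ (then $E$ has a unique global minimizer $u$). Lipschitz derivative of $E$: there is $L$ with $\|E'(w)-E'(v)\|_{\mathcal V'}\le L\|w-v\|_{\mathcal V}$ for all $v,w\in\mathcal B$. Space decomposition: $\mathcal V=\mathcal V_1+\cdots+\mathcal V_N$ with closed subspaces $\mathcal V_i\subseteq\mathcal V$. Stable decomposition: there is $C_A>0$ such that each $v\in\mathcal V$ can be written $v=\sum_{i=1}^Nv_i$, $v_i\in\mathcal V_i$, with $\sum_{i=1}^N\|v_i\|_{\mathcal V}^2\le C_A^2\|v\|_{\mathcal V}^2$. Strengthened Cauchy--Schwarz inequality: there is $C_S>0$ such that for any $w_{i,j}\in\mathcal B$, $u_j\in\mathcal V_j$, $v_i\in\mathcal V_i$ with $w_{i,j}+u_j\in\mathcal B$, $$\sum_{i=1}^N\sum_{j=i+1}^N\langle E'(w_{i,j}+u_j)-E'(w_{i,j}),v_i\rangle\le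 C_S\Bigl(\sum_{i=1}^N\|u_i\|_{\mathcal V}^2\Bigr)^{1/2}\Bigl(\sum_{i=1}^N\|v_i\|_{\mathcal V}^2\Bigr)^{1/2}.$$ Local objects: $R_i:\mathcal V'\to\mathcal V_i'$ is restriction of functionals to $\mathcal V_i$; $Q_i:\mathcal V\to\mathcal V_i$ is a (linear) projection, $Q_iv=v$ for $v\in\mathcal V_i$; $E_i:\mathcal V_i\to\mathbb R$ is Fréchet differentiable. Strong convexity of $E_i$: there is $\mu_i>0$ with $\langle E_i'(w)-E_i'(v),w-v\rangle\ge\mu_i\|w-v\|_{\mathcal V}^2$ for all $v,w\in\mathcal V_i$. Put $\chi=\frac{2L^2}{\mu\min_i\mu_i^2}(E(u_0)-E(u))$, $\mathcal B^+=\{v\in\mathcal V:\operatorname{dist}(v,\mathcal B)\le\sqrt\chi\}$, $\mathcal B_i=Q_i\mathcal B^+$. Lipschitz derivative of $E_i$: there is $L_i>0$ with $\|E_i'(w)-E_i'(v)\|_{\mathcal V_i'}\le L_i\|w-v\|_{\mathcal V}$ for all $w,v\in\mathcal B_i$ (dual norm over $\mathcal V_i$ with the norm $\|\cdot\|_{\mathcal V}$). FASD-ALS algorithm, $u^{k+1}=\text{FASD-ALS}(u^k)$: set $v_0=u^k$. For $i=1,\dots,N$: let $\xi_i=Q_iv_{i-1}$, $\tau_i=E_i'(\xi_i)-R_iE'(v_{i-1})\in\mathcal V_i'$; find $\eta_i\in\mathcal V_i$ with $\langle E_i'(\eta_i),w\rangle=\langle\tau_i,w\rangle$ for all $w\in\mathcal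 V_i$; set $s_i=\eta_i-\xi_i$, $\alpha_i^q=-\frac{\langle R_iE'(v_{i-1}),s_i\rangle}{L\|s_i\|_{\mathcal V}^2}$, and $v_i=v_{i-1}+\alpha_i^qs_i$ (with $v_i=v_{i-1}$ if $s_i=0$). Finally $u^{k+1}=v_N$. *)

theory Defs
  imports "HOL-Analysis.Analysis"
begin

text \<open>
  Subspaces of the ambient Hilbert space are sets, indexed by \<open>{1..N}\<close>. A functional on a subspace
  \<open>S\<close> is represented by a bounded functional on the whole space of which only the values on \<open>S\<close>
  are ever used (every bounded functional on a closed \<open>S\<close> has such an extension). Accordingly,
  the restriction operators \<open>R i\<close> leave no trace in the formulas below: a functional on the
  whole space is restricted by testing it on elements of \<open>V i\<close> only. The local energies
  \<open>Es i\<close> are total functions whose values outside \<open>V i\<close> are irrelevant.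
\<close>

definition space_decomposition ::
  "nat \<Rightarrow> (nat \<Rightarrow> 'a::real_normed_vector set) \<Rightarrow> bool" where
  "space_decomposition N V \<longleftrightarrow>
     (\<forall>i\<in>{1..N}. subspace (V i) \<and> closed (V i)) \<and>
     (\<forall>v. \<exists>x. (\<forall>i\<in>{1..N}. x i \<in> V i) \<and> v = (\<Sum>i=1..N. x i))"

definition stable_decomposition ::
  "nat \<Rightarrow> (nat \<Rightarrow> 'a::real_normed_vector set) \<Rightarrow> real \<Rightarrow> bool" where
  "stable_decomposition N V C\<^sub>A \<longleftrightarrow>
     C\<^sub>A > 0 \<and>
     (\<forall>v. \<exists>x. (\<forall>i\<in>{1..N}. x i \<in> V i) \<and> v = (\<Sum>i=1..N. x i) \<and>
        (\<Sum>i=1..N. (norm (x i))\<^sup>2) \<le> C\<^sub>A\<^sup>2 * (norm v)\<^sup>2)"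

definition sublevel :: "('a \<Rightarrow> real) \<Rightarrow> 'a \<Rightarrow> 'a set" where
  "sublevel E u0 = {v. E v \<le> E u0}"

definition strengthened_Cauchy_Schwarz ::
  "nat \<Rightarrow> (nat \<Rightarrow> 'a::real_normed_vector set) \<Rightarrow> 'a set \<Rightarrow> ('a \<Rightarrow> 'a \<Rightarrow>\<^sub>L real) \<Rightarrow> real \<Rightarrow> bool" where
  "strengthened_Cauchy_Schwarz N V B E' C\<^sub>S \<longleftrightarrow>
     C\<^sub>S > 0 \<and>
     (\<forall>w x y.
        (\<forall>i\<in>{1..N}. \<forall>j\<in>{1..N}. w i j \<in> B \<and> w i j + x j \<in> B) \<longrightarrow>
        (\<forall>j\<in>{1..N}. x j \<in> V j) \<longrightarrow>
        (\<forall>i\<in>{1..N}. y i \<in> V i) \<longrightarrow>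
        (\<Sum>i=1..N. \<Sum>j=i+1..N. blinfun_apply (E' (w i j + x j) - E' (w i j)) (y i))
          \<le> C\<^sub>S * sqrt (\<Sum>i=1..N. (norm (x i))\<^sup>2) * sqrt (\<Sum>i=1..N. (norm (y i))\<^sup>2))"

definition strongly_convex_deriv_on ::
  "'a::real_normed_vector set \<Rightarrow> ('a \<Rightarrow> 'a \<Rightarrow>\<^sub>L real) \<Rightarrow> real \<Rightarrow> bool" where
  "strongly_convex_deriv_on S E' \<mu> \<longleftrightarrow>
     \<mu> > 0 \<and>
     (\<forall>v\<in>S. \<forall>w\<in>S. \<mu> * (norm (w - v))\<^sup>2 \<le> blinfun_apply (E' w - E' v) (w - v))"

text \<open>
  The dual norm over a subspace \<open>S\<close>. Since \<open>f 0 / norm 0 = 0\<close>, admitting \<open>w = 0\<close> does not change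
  the supremum when \<open>S\<close> is nontrivial, and gives the value \<open>0\<close> when \<open>S = {0}\<close>.
\<close>

definition dual_norm_on :: "'a::real_normed_vector set \<Rightarrow> ('a \<Rightarrow>\<^sub>L real) \<Rightarrow> real" where
  "dual_norm_on S f = (SUP w\<in>S. blinfun_apply f w / norm w)"

definition fasd_chi ::
  "nat \<Rightarrow> ('a \<Rightarrow> real) \<Rightarrow> 'a \<Rightarrow> 'a \<Rightarrow> real \<Rightarrow> real \<Rightarrow> (nat \<Rightarrow> real) \<Rightarrow> real" where
  "fasd_chi N E u0 u L \<mu> \<mu>s = 2 * L\<^sup>2 / (\<mu> * (MIN i\<in>{1..N}. \<mu>s i)\<^sup>2) * (E u0 - E u)"

definition enlargement :: "'a::metric_space set \<Rightarrow> real \<Rightarrow> 'a set" where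
  "enlargement B r = {v. infdist v B \<le> r}"

text \<open>
  One iteration \<open>a \<mapsto> b\<close>, as a relation: the local solutions \<open>\<eta> i\<close> are characterised by their
  variational equation. \<open>E'\<close> and \<open>Es' i\<close> are the derivatives of \<open>E\<close> and of the local energies,
  and the difference \<open>Es' i (\<xi> i) - E' (v (i - 1))\<close>, tested on \<open>V i\<close>, is the functional \<open>\<tau> i\<close>.
\<close>

definition fasd_als_step ::
  "nat \<Rightarrow> (nat \<Rightarrow> 'a::real_normed_vector set) \<Rightarrow> (nat \<Rightarrow> 'a \<Rightarrow> 'a) \<Rightarrow> ('a \<Rightarrow> 'a \<Rightarrow>\<^sub>L real) \<Rightarrow>
   (nat \<Rightarrow> 'a \<Rightarrow> 'a \<Rightarrow>\<^sub>L real) \<Rightarrow> real \<Rightarrow> 'a \<Rightarrow> 'a \<Rightarrow> bool" where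
  "fasd_als_step N V Q E' Es' L a b \<longleftrightarrow>
     (\<exists>v \<xi> \<tau> \<eta> s \<alpha>.
        v 0 = a \<and>
        (\<forall>i\<in>{1..N}.
           \<xi> i = Q i (v (i - 1)) \<and>
           \<tau> i = Es' i (\<xi> i) - E' (v (i - 1)) \<and>
           \<eta> i \<in> V i \<and>
           (\<forall>w\<in>V i. blinfun_apply (Es' i (\<eta> i)) w = blinfun_apply (\<tau> i) w) \<and>
           s i = \<eta> i - \<xi> i \<and>
           \<alpha> i = - blinfun_apply (E' (v (i - 1))) (s i) / (L * (norm (s i))\<^sup>2) \<and>
           v i = (if s i = 0 then v (i - 1) else v (i - 1) + \<alpha> i *\<^sub>R s i)) \<and>
        b = v N)"

definition fasd_rate ::
  "nat \<Rightarrow> real \<Rightarrow> real \<Rightarrow> real \<Rightarrow> real \<Rightarrow> (nat \<Rightarrow> real) \<Rightarrow> (nat \<Rightarrow> real) \<Rightarrow> real" where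
  "fasd_rate N C\<^sub>A C\<^sub>S L \<mu> Ls \<mu>s =
     (let K = C\<^sub>A\<^sup>2 * (C\<^sub>S + L * (1 + (MAX i\<in>{1..N}. Ls i / \<mu>s i)))\<^sup>2
      in K / (K + L * \<mu>))"

end

theory Submission
  imports Defs
begin

text \<open>
  Each local correction \<open>d i = v i - v (i - 1)\<close> satisfies \<open>E' (v (i - 1)) (d i) = - L * (norm (d i))\<^sup>2\<close>,
  so the descent lemma makes \<open>E\<close> drop by at least \<open>L / 2 * (norm (d i))\<^sup>2\<close>. Conversely, writing \<open>w\<close> as a
  stable sum of \<open>w i \<in> V i\<close> and telescoping \<open>E' (v N)\<close> along \<open>v i, \<dots>, v N\<close> bounds the dual norm of
  \<open>E' (v N)\<close> by the \<open>\<ell>\<^sup>2\<close> norm \<open>D\<close> of the corrections, and strong convexity turns this into a bound of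
  \<open>E (v N) - E u\<close> by a multiple of \<open>D\<^sup>2\<close>, hence by a multiple of the energy drop.
\<close>

section \<open>Differentiable strongly convex energies\<close>

lemma has_real_derivative_along_line:
  fixes E :: "'a::real_normed_vector \<Rightarrow> real" and E' :: "'a \<Rightarrow> 'a \<Rightarrow>\<^sub>L real"
  assumes "\<And>v. (E has_derivative blinfun_apply (E' v)) (at v)"
  shows "((\<lambda>t. E (v + t *\<^sub>R d)) has_real_derivative E' (v + t *\<^sub>R d) d) (at t)"
proof -
  have "((\<lambda>t. v + t *\<^sub>R d) has_derivative (\<lambda>h. h *\<^sub>R d)) (at t)"
    by (auto intro!: derivative_eq_intros)
  from has_derivative_compose[OF this assms]
  show ?thesis
    by (simp add: has_field_derivative_def blinfun.scaleR_right mult.commute[of _ "E' (v + t *\<^sub>R d) d"])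
qed

text \<open>Subtracting the tangent and the quadratic term from \<open>E\<close> along the segment
  leaves a function \<open>g\<close> whose slope is nonnegative by strong monotonicity of
  \<open>E'\<close>.\<close>

lemma strongly_convex_gradient_inequality:
  fixes E :: "'a::real_normed_vector \<Rightarrow> real" and E' :: "'a \<Rightarrow> 'a \<Rightarrow>\<^sub>L real"
  assumes deriv: "\<And>v. (E has_derivative blinfun_apply (E' v)) (at v)"
    and convex: "strongly_convex_deriv_on UNIV E' \<mu>"
  shows "E v + E' v (w - v) + \<mu> / 2 * (norm (w - v))\<^sup>2 \<le> E w"
proof -
  define d where "d = w - v"
  define g where "g t = E (v + t *\<^sub>R d) - t * E' v d - \<mu> / 2 * t\<^sup>2 * (norm d)\<^sup>2" for t
  have "g 0 \<le> g 1"
  proof (rule DERIV_nonneg_imp_nondecreasing[of 0 1 g])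
    fix t :: real
    assume t: "0 \<le> t" "t \<le> 1"
    have "(g has_real_derivative E' (v + t *\<^sub>R d) d - E' v d - \<mu> * t * (norm d)\<^sup>2) (at t)"
      unfolding g_def
      by (auto intro!: derivative_eq_intros has_real_derivative_along_line[OF deriv])
    \<comment> \<open>Convexity between \<open>v + t *\<^sub>R d\<close> and \<open>v\<close>
      carries a common factor \<open>t\<close>, which cancels only away from 0; at
      \<open>t = 0\<close> the slope vanishes.\<close>
    moreover have "0 \<le> E' (v + t *\<^sub>R d) d - E' v d - \<mu> * t * (norm d)\<^sup>2"
    proof (cases "t = 0")
      case False
      have "\<mu> * (norm (t *\<^sub>R d))\<^sup>2 \<le> (E' (v + t *\<^sub>R d) - E' v) (t *\<^sub>R d)"
        using convex unfolding strongly_convex_deriv_on_def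
        by (metis UNIV_I add_diff_cancel_left')
      then have "t * (\<mu> * t * (norm d)\<^sup>2) \<le> t * (E' (v + t *\<^sub>R d) d - E' v d)"
        by (simp add: blinfun.scaleR_right blinfun.diff_left power2_eq_square algebra_simps)
      then show ?thesis
        using t False by simp
    qed simp
    ultimately show "\<exists>y. (g has_real_derivative y) (at t) \<and> 0 \<le> y"
      by blast
  qed simp
  then show ?thesis
    by (simp add: g_def d_def)
qed

lemma deriv_zero_at_minimizer:
  fixes E :: "'a::real_normed_vector \<Rightarrow> real" and E' :: "'a \<Rightarrow> 'a \<Rightarrow>\<^sub>L real"
  assumes "(E has_derivative blinfun_apply (E' u)) (at u)" and "\<And>v. E u \<le> E v"
  shows "E' u = 0"
  using differential_zero_maxmin[of u UNIV E "blinfun_apply (E' u)"] assms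
  by (auto intro!: blinfun_eqI)

text \<open>The condition on \<open>d\<close> is what the step length of the approximate line search
  achieves: \<open>t = 1\<close> minimizes the quadratic model
  \<open>E v + t * E' v d + L / 2 * t\<^sup>2 * (norm d)\<^sup>2\<close>.\<close>

lemma descent_within_sublevel:
  fixes E :: "'a::real_normed_vector \<Rightarrow> real" and E' :: "'a \<Rightarrow> 'a \<Rightarrow>\<^sub>L real"
  assumes deriv: "\<And>v. (E has_derivative blinfun_apply (E' v)) (at v)"
    and lipschitz: "\<And>v w. v \<in> sublevel E u0 \<Longrightarrow> w \<in> sublevel E u0 \<Longrightarrow>
           norm (E' w - E' v) \<le> L * norm (w - v)"
    and L: "L > 0"
    and v: "v \<in> sublevel E u0"
    and d: "E' v d = - L * (norm d)\<^sup>2"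
  shows "E (v + d) \<le> E v - L / 2 * (norm d)\<^sup>2"
proof (cases "d = 0")
  case False
  define g where "g t = E (v + t *\<^sub>R d)" for t
  have g': "(g has_real_derivative E' (v + t *\<^sub>R d) d) (at t)" for t
    unfolding g_def by (rule has_real_derivative_along_line[OF deriv])
  \<comment> \<open>The guard \<open>g t \<le> g 0\<close> puts the point in the sublevel set, so
    the Lipschitz bound lets the slope rise by at most \<open>L * t * (norm d)\<^sup>2\<close> from
    its initial value.\<close>
  have slope: "E' (v + t *\<^sub>R d) d \<le> - L * (norm d)\<^sup>2 * (1 - t)" if "0 \<le> t" "g t \<le> g 0" for t
  proof -
    have "E' (v + t *\<^sub>R d) d - E' v d \<le> norm ((E' (v + t *\<^sub>R d) - E' v) d)"
      by (simp add: blinfun.diff_left)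
    also have "\<dots> \<le> norm (E' (v + t *\<^sub>R d) - E' v) * norm d"
      by (rule norm_blinfun)
    also have "\<dots> \<le> L * norm (t *\<^sub>R d) * norm d"
      using lipschitz[OF v, of "v + t *\<^sub>R d"] v that
      by (intro mult_right_mono) (auto simp: sublevel_def g_def)
    finally show ?thesis
      using that d by (simp add: power2_eq_square algebra_simps)
  qed
  \<comment> \<open>The Lipschitz bound is only available in the sublevel set, so we first have to see that the
    segment stays there: at the last time \<open>T\<close> in it the slope of \<open>g\<close> would be negative.\<close>
  have stay: "g t \<le> g 0" if t: "0 \<le> t" "t \<le> 1" for t
  proof -
    define A where "A = {0..t} \<inter> {x. g x \<le> g 0}"
    have "continuous_on UNIV g"
      using g' DERIV_isCont by (intro continuous_at_imp_continuous_on) blast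
    then have "closed {x. g x \<le> g 0}"
      by (intro closed_Collect_le) auto
    then have "compact A"
      unfolding A_def by (intro compact_Int_closed) auto
    moreover have "0 \<in> A"
      using t by (simp add: A_def)
    ultimately obtain T where T: "T \<in> A" and T_max: "\<And>x. x \<in> A \<Longrightarrow> x \<le> T"
      using compact_attains_sup[of A] by blast
    have "T = t"
    proof (rule ccontr)
      assume "T \<noteq> t"
      with T have T': "0 \<le> T" "T < t" "g T \<le> g 0"
        by (auto simp: A_def)
      have "E' (v + T *\<^sub>R d) d < 0"
      proof -
        have "0 < L * (norm d)\<^sup>2 * (1 - T)"
          using L False T' t by simp
        then show ?thesis
          using slope[of T] T' by linarith
      qed
      from DERIV_neg_dec_right[OF g' this]
      obtain e where e: "e > 0" "\<And>h. 0 < h \<Longrightarrow> h < e \<Longrightarrow> g (T + h) < g T"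
        by blast
      \<comment> \<open>Halving \<open>e\<close> keeps \<open>h\<close> strictly below it, and the
        cap \<open>t - T\<close> keeps \<open>T + h\<close> in the interval, hence in
        \<open>A\<close> beyond its maximum.\<close>
      define h where "h = min (e / 2) (t - T)"
      have h: "0 < h" "h < e" "T + h \<le> t"
        using e T' by (auto simp: h_def)
      with e(2)[of h] T' have "T + h \<in> A"
        by (simp add: A_def)
      then show False
        using T_max[of "T + h"] h by simp
    qed
    then show ?thesis
      using T by (simp add: A_def)
  qed
  \<comment> \<open>The added term is an antiderivative of the negated slope bound, worth
    \<open>L / 2 * (norm d)\<^sup>2\<close> at \<open>t = 1\<close>.\<close>
  define f where "f t = g t + L * (norm d)\<^sup>2 * (t - t\<^sup>2 / 2)" for t
  have "f 1 \<le> f 0"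
  proof (rule DERIV_nonpos_imp_nonincreasing[of 0 1 f])
    fix t :: real
    assume t: "0 \<le> t" "t \<le> 1"
    have "(f has_real_derivative E' (v + t *\<^sub>R d) d + L * (norm d)\<^sup>2 * (1 - t)) (at t)"
      unfolding f_def by (auto intro!: derivative_eq_intros g')
    moreover have "E' (v + t *\<^sub>R d) d + L * (norm d)\<^sup>2 * (1 - t) \<le> 0"
      using slope[OF t(1) stay[OF t]] by simp
    ultimately show "\<exists>y. (f has_real_derivative y) (at t) \<and> y \<le> 0"
      by blast
  qed simp
  then show ?thesis
    by (simp add: f_def g_def algebra_simps)
qed simp

section \<open>Dual norms and local problems\<close>

lemma dual_norm_on_bound:
  fixes f :: "'a::real_normed_vector \<Rightarrow>\<^sub>L real"
  assumes "w \<in> S"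
  shows "f w \<le> dual_norm_on S f * norm w"
proof (cases "w = 0")
  case False
  \<comment> \<open>A real supremum dominates its members only if they are bounded above; the norm
    of \<open>f\<close> on the whole space supplies the bound.\<close>
  have "f x / norm x \<le> norm f" for x
    using norm_blinfun[of f x] by (cases "x = 0") (auto simp: divide_simps abs_le_iff)
  then have "bdd_above ((\<lambda>x. f x / norm x) ` S)"
    by (intro bdd_aboveI2)
  then have "f w / norm w \<le> dual_norm_on S f"
    unfolding dual_norm_on_def using assms by (intro cSUP_upper)
  then show ?thesis
    using False by (simp add: divide_simps mult.commute)
qed simp

text \<open>Testing the local equation with the correction itself turns the increment of
  \<open>G'\<close> into \<open>- f\<close>, so strong convexity makes the correction a descent
  direction.\<close>

lemma local_correction_slope:
  assumes "subspace S" and "\<xi> \<in> S" and "\<eta> \<in> S"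
    and convex: "strongly_convex_deriv_on S G' m"
    and "\<And>w. w \<in> S \<Longrightarrow> blinfun_apply (G' \<eta>) w = (G' \<xi> - f) w"
  shows "m * (norm (\<eta> - \<xi>))\<^sup>2 \<le> - blinfun_apply f (\<eta> - \<xi>)"
proof -
  have "m * (norm (\<eta> - \<xi>))\<^sup>2 \<le> (G' \<eta> - G' \<xi>) (\<eta> - \<xi>)"
    using convex assms(2,3) by (auto simp: strongly_convex_deriv_on_def)
  also have "\<dots> = - f (\<eta> - \<xi>)"
    using assms(5)[of "\<eta> - \<xi>"] subspace_diff[OF assms(1,3,2)] by (simp add: blinfun.diff_left)
  finally show ?thesis .
qed

text \<open>This makes the algorithm stationary at the minimizer and keeps corrected points in the
  enlarged sublevel set.\<close>

lemma local_correction_norm_bound: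
  assumes "subspace S" and "\<xi> \<in> S" and "\<eta> \<in> S"
    and "strongly_convex_deriv_on S G' m"
    and "\<And>w. w \<in> S \<Longrightarrow> blinfun_apply (G' \<eta>) w = (G' \<xi> - f) w"
  shows "m * norm (\<eta> - \<xi>) \<le> norm f"
proof (cases "\<eta> = \<xi>")
  case False
  have "m * norm (\<eta> - \<xi>) * norm (\<eta> - \<xi>) \<le> norm f * norm (\<eta> - \<xi>)"
    using local_correction_slope[OF assms] norm_blinfun[of f "\<eta> - \<xi>"]
    by (simp add: power2_eq_square mult.assoc abs_le_iff)
  then show ?thesis
    using False by simp
qed simp

section \<open>Estimates for a full sweep of corrections\<close>

text \<open>Each \<open>E' (v N) (x i)\<close> is compared with \<open>E' (v i) (x i)\<close>. The
  difference collects the later corrections and is handled by the strengthened Cauchy-Schwarz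
  inequality; the Lipschitz bound and \<open>residual\<close> control the rest.\<close>

lemma subspace_correction_dual_bound:
  fixes E' :: "'a::real_normed_vector \<Rightarrow> 'a \<Rightarrow>\<^sub>L real" and v :: "nat \<Rightarrow> 'a"
  assumes stable: "stable_decomposition N V C\<^sub>A"
    and SCS: "strengthened_Cauchy_Schwarz N V B E' C\<^sub>S"
    and lipschitz: "\<And>x y. x \<in> B \<Longrightarrow> y \<in> B \<Longrightarrow> norm (E' y - E' x) \<le> L * norm (y - x)"
    and B: "\<And>i. i \<le> N \<Longrightarrow> v i \<in> B"
    and V: "\<And>i. i \<in> {1..N} \<Longrightarrow> v i - v (i - 1) \<in> V i"
    and residual: "\<And>i w. i \<in> {1..N} \<Longrightarrow> w \<in> V i \<Longrightarrow>
           E' (v (i - 1)) w \<le> K * norm (v i - v (i - 1)) * norm w"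
    and LK: "0 \<le> L" "0 \<le> K"
  shows "E' (v N) w \<le> C\<^sub>A * (C\<^sub>S + L + K) * sqrt (\<Sum>i=1..N. (norm (v i - v (i - 1)))\<^sup>2) * norm w"
proof -
  define d where "d i = v i - v (i - 1)" for i
  define D where "D = sqrt (\<Sum>i=1..N. (norm (d i))\<^sup>2)"
  obtain x where x: "\<And>i. i \<in> {1..N} \<Longrightarrow> x i \<in> V i" and w: "w = (\<Sum>i=1..N. x i)"
    and x_le: "(\<Sum>i=1..N. (norm (x i))\<^sup>2) \<le> C\<^sub>A\<^sup>2 * (norm w)\<^sup>2"
    using stable unfolding stable_decomposition_def by blast
  define X where "X = sqrt (\<Sum>i=1..N. (norm (x i))\<^sup>2)"
  have C\<^sub>A: "C\<^sub>A > 0" and C\<^sub>S: "C\<^sub>S > 0"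
    using stable SCS by (auto simp: stable_decomposition_def strengthened_Cauchy_Schwarz_def)
  have "X \<le> sqrt ((C\<^sub>A * norm w)\<^sup>2)"
    unfolding X_def using x_le by (intro real_sqrt_le_mono) (simp add: power_mult_distrib)
  then have X_le: "X \<le> C\<^sub>A * norm w"
    using C\<^sub>A by simp
  have "0 \<le> D"
    by (simp add: D_def sum_nonneg)
  have telescope: "(\<Sum>j=i+1..N. (E' (v (j - 1) + d j) - E' (v (j - 1))) y)
      = E' (v N) y - E' (v i) y" if "i \<le> N" for i y
    using sum_telescope''[OF that, of "\<lambda>k. E' (v k) y"] by (simp add: d_def blinfun.diff_left)
  \<comment> \<open>The base point for the pair \<open>i\<close>, \<open>j\<close> is
    \<open>v (j - 1)\<close>, independent of \<open>i\<close>, so adding \<open>d j\<close> gives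
    \<open>v j\<close> and the inner sums telescope.\<close>
  have "(\<Sum>i=1..N. \<Sum>j=i+1..N. (E' (v (j - 1) + d j) - E' (v (j - 1))) (x i)) \<le> C\<^sub>S * D * X"
    using SCS unfolding strengthened_Cauchy_Schwarz_def D_def X_def
    by (elim conjE allE[of _ "\<lambda>i j. v (j - 1)"] allE[of _ d] allE[of _ x])
      (use B V x in \<open>auto simp: d_def\<close>)
  also have "(\<Sum>i=1..N. \<Sum>j=i+1..N. (E' (v (j - 1) + d j) - E' (v (j - 1))) (x i)) =
      (\<Sum>i=1..N. E' (v N) (x i) - E' (v i) (x i))"
    by (intro sum.cong refl telescope) auto
  finally have tail: "(\<Sum>i=1..N. E' (v N) (x i) - E' (v i) (x i)) \<le> C\<^sub>S * D * X" .
  have local: "E' (v i) (x i) \<le> (L + K) * (norm (d i) * norm (x i))" if i: "i \<in> {1..N}" for i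
  proof -
    have "(E' (v i) - E' (v (i - 1))) (x i) \<le> norm (E' (v i) - E' (v (i - 1))) * norm (x i)"
      using norm_blinfun[of "E' (v i) - E' (v (i - 1))" "x i"] by simp
    also have "\<dots> \<le> L * norm (d i) * norm (x i)"
      unfolding d_def using i by (intro mult_right_mono lipschitz B) auto
    finally show ?thesis
      using residual[OF i x[OF i]] by (simp add: d_def blinfun.diff_left algebra_simps)
  qed
  have "(\<Sum>i=1..N. E' (v i) (x i)) \<le> (L + K) * (\<Sum>i=1..N. norm (d i) * norm (x i))"
    unfolding sum_distrib_left by (intro sum_mono local)
  also have "\<dots> \<le> (L + K) * (D * X)"
    using L2_set_mult_ineq[of "\<lambda>i. norm (d i)" "\<lambda>i. norm (x i)" "{1..N}"] LK
    by (intro mult_left_mono) (auto simp: D_def X_def L2_set_def)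
  finally have "E' (v N) w \<le> (C\<^sub>S + L + K) * D * X"
    using tail by (simp add: w blinfun.sum_right sum_subtractf algebra_simps)
  also have "\<dots> \<le> (C\<^sub>S + L + K) * D * (C\<^sub>A * norm w)"
    using X_le LK C\<^sub>S \<open>0 \<le> D\<close> by (intro mult_left_mono) auto
  finally show ?thesis
    by (simp add: D_def d_def mult_ac)
qed

lemma subspace_correction_contraction:
  fixes E :: "'a::real_normed_vector \<Rightarrow> real" and E' :: "'a \<Rightarrow> 'a \<Rightarrow>\<^sub>L real"
    and v :: "nat \<Rightarrow> 'a"
  assumes deriv: "\<And>v. (E has_derivative blinfun_apply (E' v)) (at v)"
    and convex: "strongly_convex_deriv_on UNIV E' \<mu>"
    and L: "L > 0"
    and drop: "\<And>i. i \<in> {1..N} \<Longrightarrow>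
           L / 2 * (norm (v i - v (i - 1)))\<^sup>2 \<le> E (v (i - 1)) - E (v i)"
    and dual: "\<And>w. E' (v N) w \<le> M * sqrt (\<Sum>i=1..N. (norm (v i - v (i - 1)))\<^sup>2) * norm w"
  shows "E (v N) - E u \<le> M\<^sup>2 / (M\<^sup>2 + L * \<mu>) * (E (v 0) - E u)"
proof -
  define S where "S = (\<Sum>i=1..N. (norm (v i - v (i - 1)))\<^sup>2)"
  define r where "r = norm (u - v N)"
  have \<mu>: "\<mu> > 0"
    using convex by (simp add: strongly_convex_deriv_on_def)
  have "L / 2 * S \<le> (\<Sum>i=1..N. E (v (i - 1)) - E (v i))"
    unfolding S_def sum_distrib_left by (intro sum_mono drop)
  also have "\<dots> = E (v 0) - E (v N)"
    using sum_telescope''[of 0 N "\<lambda>k. - E (v k)"] by simp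
  finally have S_le: "L * S \<le> 2 * (E (v 0) - E (v N))"
    by simp
  have "E' (v N) (v N - u) \<le> M * sqrt S * r"
    using dual[of "v N - u"] by (simp add: S_def r_def norm_minus_commute)
  moreover have "E' (v N) (u - v N) = - E' (v N) (v N - u)"
    by (simp add: blinfun.diff_right)
  ultimately have "E (v N) - E u \<le> M * sqrt S * r - \<mu> / 2 * r\<^sup>2"
    using strongly_convex_gradient_inequality[OF deriv convex, of "v N" u] by (simp add: r_def)
  then have "2 * \<mu> * (E (v N) - E u) \<le> 2 * \<mu> * (M * sqrt S * r - \<mu> / 2 * r\<^sup>2)"
    using \<mu> by simp
  \<comment> \<open>Completing the square eliminates the unknown distance \<open>r\<close>.\<close>
  also have "\<dots> = (M * sqrt S)\<^sup>2 - (M * sqrt S - \<mu> * r)\<^sup>2"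
    by (simp add: power2_eq_square algebra_simps)
  also have "\<dots> \<le> M\<^sup>2 * S"
    by (simp add: power_mult_distrib S_def sum_nonneg)
  finally have "L * (2 * \<mu> * (E (v N) - E u)) \<le> L * (M\<^sup>2 * S)"
    using L by (intro mult_left_mono) auto
  also have "\<dots> \<le> M\<^sup>2 * (2 * (E (v 0) - E (v N)))"
    using mult_left_mono[OF S_le, of "M\<^sup>2"] by (simp add: mult_ac)
  \<comment> \<open>Up to a factor 2, \<open>L * \<mu>\<close> times the new error is at most
    \<open>M\<^sup>2\<close> times the energy drop. Writing the drop as old minus new error and
    collecting the new error yields the rate.\<close>
  finally have "(M\<^sup>2 + L * \<mu>) * (E (v N) - E u) \<le> M\<^sup>2 * (E (v 0) - E u)"
    by (simp add: algebra_simps)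
  moreover have "M\<^sup>2 + L * \<mu> > 0"
    using L \<mu> by (simp add: add_nonneg_pos)
  ultimately show ?thesis
    by (simp add: field_simps)
qed

section \<open>Convergence of the FASD-ALS iteration\<close>

theorem corollary5p4:
  fixes E :: "'a::{real_inner, complete_space} \<Rightarrow> real"
    and E' :: "'a \<Rightarrow> 'a \<Rightarrow>\<^sub>L real"
    and N :: nat
    and V :: "nat \<Rightarrow> 'a set"
    and Q :: "nat \<Rightarrow> 'a \<Rightarrow> 'a"
    and Es :: "nat \<Rightarrow> 'a \<Rightarrow> real"
    and Es' :: "nat \<Rightarrow> 'a \<Rightarrow> 'a \<Rightarrow>\<^sub>L real"
    and \<mu> L C\<^sub>A C\<^sub>S :: real
    and \<mu>s Ls :: "nat \<Rightarrow> real"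
    and u0 u :: 'a
    and us :: "nat \<Rightarrow> 'a"
  assumes N: "N \<ge> 1"
    and E_deriv: "\<And>v. (E has_derivative blinfun_apply (E' v)) (at v)"
    and E_convex: "strongly_convex_deriv_on UNIV E' \<mu>"
    and E_lipschitz: "\<And>v w. v \<in> sublevel E u0 \<Longrightarrow> w \<in> sublevel E u0 \<Longrightarrow>
           norm (E' w - E' v) \<le> L * norm (w - v)"
    and u_minimizer: "\<And>v. E u \<le> E v"
    and decomposition: "space_decomposition N V"
    and stable: "stable_decomposition N V C\<^sub>A"
    and SCS: "strengthened_Cauchy_Schwarz N V (sublevel E u0) E' C\<^sub>S"
    and Q_linear: "\<And>i. i \<in> {1..N} \<Longrightarrow> linear (Q i)"
    and Q_range: "\<And>i v. i \<in> {1..N} \<Longrightarrow> Q i v \<in> V i"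
    and Q_proj: "\<And>i v. i \<in> {1..N} \<Longrightarrow> v \<in> V i \<Longrightarrow> Q i v = v"
    and Es_deriv: "\<And>i v. i \<in> {1..N} \<Longrightarrow> v \<in> V i \<Longrightarrow>
           (Es i has_derivative blinfun_apply (Es' i v)) (at v within V i)"
    and Es_convex: "\<And>i. i \<in> {1..N} \<Longrightarrow> strongly_convex_deriv_on (V i) (Es' i) (\<mu>s i)"
    and Ls_pos: "\<And>i. i \<in> {1..N} \<Longrightarrow> Ls i > 0"
    and Es_lipschitz: "\<And>i v w. i \<in> {1..N} \<Longrightarrow>
           v \<in> Q i ` enlargement (sublevel E u0) (sqrt (fasd_chi N E u0 u L \<mu> \<mu>s)) \<Longrightarrow>
           w \<in> Q i ` enlargement (sublevel E u0) (sqrt (fasd_chi N E u0 u L \<mu> \<mu>s)) \<Longrightarrow>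
           dual_norm_on (V i) (Es' i w - Es' i v) \<le> Ls i * norm (w - v)"
    and us_0: "us 0 = u0"
    and us_Suc: "\<And>n. fasd_als_step N V Q E' Es' L (us n) (us (Suc n))"
  shows "E (us (Suc k)) - E u \<le> fasd_rate N C\<^sub>A C\<^sub>S L \<mu> Ls \<mu>s * (E (us k) - E u)"
proof -
  define B where "B = sublevel E u0"
  \<comment> \<open>Here \<open>\<rho>\<close> is the squared radius of the enlargement, not the
    contraction factor.\<close>
  define \<rho> where "\<rho> = fasd_chi N E u0 u L \<mu> \<mu>s"
  define \<kappa> where "\<kappa> = (MAX i\<in>{1..N}. Ls i / \<mu>s i)"
  define M where "M = C\<^sub>A * (C\<^sub>S + L * (1 + \<kappa>))"
  have rate: "fasd_rate N C\<^sub>A C\<^sub>S L \<mu> Ls \<mu>s = M\<^sup>2 / (M\<^sup>2 + L * \<mu>)"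
    by (simp add: fasd_rate_def M_def \<kappa>_def Let_def power_mult_distrib)
  have \<mu>: "\<mu> > 0"
    using E_convex by (simp add: strongly_convex_deriv_on_def)
  have \<mu>s: "\<mu>s i > 0" if "i \<in> {1..N}" for i
    using Es_convex[OF that] by (simp add: strongly_convex_deriv_on_def)
  have V: "subspace (V i)" if "i \<in> {1..N}" for i
    using decomposition that by (simp add: space_decomposition_def)
  have E'_u: "E' u = 0"
    using deriv_zero_at_minimizer[of E E' u] E_deriv u_minimizer by blast
  show ?thesis
  proof (cases "u0 = u")
    \<comment> \<open>Here the sublevel set is a singleton, so \<open>L\<close> need not be positive.\<close>
    case True
    have "us n = u" for n
    proof (induction n)
      case 0
      then show ?case using us_0 True by simp
    next
      case (Suc n)
      from us_Suc[of n, unfolded fasd_als_step_def Suc] obtain v \<xi> \<tau> \<eta> s \<alpha> where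
        v0: "v 0 = u" and vN: "us (Suc n) = v N" and
        step: "\<forall>i\<in>{1..N}.
           \<xi> i = Q i (v (i - 1)) \<and>
           \<tau> i = Es' i (\<xi> i) - E' (v (i - 1)) \<and>
           \<eta> i \<in> V i \<and>
           (\<forall>w\<in>V i. blinfun_apply (Es' i (\<eta> i)) w = blinfun_apply (\<tau> i) w) \<and>
           s i = \<eta> i - \<xi> i \<and>
           \<alpha> i = - blinfun_apply (E' (v (i - 1))) (s i) / (L * (norm (s i))\<^sup>2) \<and>
           v i = (if s i = 0 then v (i - 1) else v (i - 1) + \<alpha> i *\<^sub>R s i)"
        by blast
      have "v i = u" if "i \<le> N" for i
        using that
      proof (induction i)
        case 0
        then show ?case using v0 by simp
      next
        case (Suc i)
        then have i: "Suc i \<in> {1..N}" and v: "v i = u"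
          by auto
        note st = step[rule_format, OF i]
        \<comment> \<open>The residual \<open>E' u\<close> vanishes, so the local correction is zero
          and the sweep never leaves \<open>u\<close>.\<close>
        have "\<mu>s (Suc i) * norm (\<eta> (Suc i) - \<xi> (Suc i)) \<le> norm (E' u)"
          using st v Q_range[OF i]
          by (intro local_correction_norm_bound[OF V[OF i] _ _ Es_convex[OF i]]) auto
        then have "s (Suc i) = 0"
          using \<mu>s[OF i] st by (auto simp: E'_u mult_le_0_iff)
        then show ?case
          using st v by simp
      qed
      then show ?case
        using vN by simp
    qed
    then show ?thesis
      by simp
  next
    case False
    have uB: "u \<in> B" and u0B: "u0 \<in> B"
      using u_minimizer by (auto simp: B_def sublevel_def)
    \<comment> \<open>Comparing strong convexity with the Lipschitz bound at the distinct points
      \<open>u\<close> and \<open>u0\<close> gives \<open>\<mu> \<le> L\<close>.\<close>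
    have L: "L > 0"
    proof -
      have "\<mu> * (norm (u - u0))\<^sup>2 \<le> (E' u - E' u0) (u - u0)"
        using E_convex by (auto simp: strongly_convex_deriv_on_def)
      also have "\<dots> \<le> norm (E' u - E' u0) * norm (u - u0)"
        using norm_blinfun[of "E' u - E' u0" "u - u0"] by simp
      also have "\<dots> \<le> L * norm (u - u0) * norm (u - u0)"
        using E_lipschitz uB u0B by (intro mult_right_mono) (auto simp: B_def)
      finally have "\<mu> \<le> L"
        using False by (simp add: power2_eq_square)
      with \<mu> show ?thesis
        by simp
    qed
    have \<kappa>: "Ls i / \<mu>s i \<le> \<kappa>" if "i \<in> {1..N}" for i
      unfolding \<kappa>_def using that by (intro Max_ge) auto
    have "\<kappa> \<ge> 0"
    proof -
      have "0 \<le> Ls 1 / \<mu>s 1"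
        using Ls_pos[of 1] \<mu>s[of 1] N by simp
      also have "\<dots> \<le> \<kappa>"
        using \<kappa>[of 1] N by simp
      finally show ?thesis .
    qed
    \<comment> \<open>This explains \<open>fasd_chi\<close>: since \<open>E' u = 0\<close>,
      \<open>norm (E' v)\<close> is at most \<open>L * norm (v - u)\<close>, and strong convexity
      bounds \<open>\<mu> / 2 * (norm (v - u))\<^sup>2\<close> by \<open>E u0 - E u\<close>.\<close>
    have correction_le: "r \<le> sqrt \<rho>"
      if i: "i \<in> {1..N}" and v: "v \<in> B" and r: "\<mu>s i * r \<le> norm (E' v)" "0 \<le> r" for i v r
    proof -
      define m where "m = (MIN i\<in>{1..N}. \<mu>s i)"
      have m: "0 < m"
        unfolding m_def using N \<mu>s by (subst Min_gr_iff) auto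
      have "m \<le> \<mu>s i"
        unfolding m_def using i by (intro Min_le) auto
      then have "m * r \<le> \<mu>s i * r"
        using r by (intro mult_right_mono)
      also have "\<dots> \<le> norm (E' v - E' u)"
        using r by (simp add: E'_u)
      also have "\<dots> \<le> L * norm (v - u)"
        using E_lipschitz uB v by (auto simp: B_def)
      finally have "(m * r)\<^sup>2 \<le> (L * norm (v - u))\<^sup>2"
        using m r by (intro power_mono) auto
      then have "\<mu> * (m * r)\<^sup>2 \<le> \<mu> * (L * norm (v - u))\<^sup>2"
        using \<mu> by simp
      also have "\<dots> = L\<^sup>2 * (\<mu> * (norm (v - u))\<^sup>2)"
        by (simp add: power_mult_distrib)
      also have "\<dots> \<le> L\<^sup>2 * (2 * (E u0 - E u))"
        using strongly_convex_gradient_inequality[OF E_deriv E_convex, of u v] v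
        by (intro mult_left_mono) (simp_all add: E'_u B_def sublevel_def)
      finally have "\<mu> * (m\<^sup>2 * r\<^sup>2) \<le> L\<^sup>2 * (2 * (E u0 - E u))"
        by (simp add: power_mult_distrib)
      then have "r\<^sup>2 \<le> \<rho>"
        unfolding \<rho>_def fasd_chi_def m_def[symmetric] using m \<mu> by (simp add: field_simps)
      then show ?thesis
        by (rule real_le_rsqrt)
    qed
    \<comment> \<open>The monotonicity conjunct keeps all iterates in \<open>B\<close>, so the
      estimate can be applied at every step.\<close>
    have one_step: "E b \<le> E a \<and> E b - E u \<le> M\<^sup>2 / (M\<^sup>2 + L * \<mu>) * (E a - E u)"
      if aB: "a \<in> B" and ab: "fasd_als_step N V Q E' Es' L a b" for a b
    proof -
      from ab[unfolded fasd_als_step_def] obtain v \<xi> \<tau> \<eta> s \<alpha> where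
        v0: "v 0 = a" and vN: "b = v N" and
        step: "\<forall>i\<in>{1..N}.
           \<xi> i = Q i (v (i - 1)) \<and>
           \<tau> i = Es' i (\<xi> i) - E' (v (i - 1)) \<and>
           \<eta> i \<in> V i \<and>
           (\<forall>w\<in>V i. blinfun_apply (Es' i (\<eta> i)) w = blinfun_apply (\<tau> i) w) \<and>
           s i = \<eta> i - \<xi> i \<and>
           \<alpha> i = - blinfun_apply (E' (v (i - 1))) (s i) / (L * (norm (s i))\<^sup>2) \<and>
           v i = (if s i = 0 then v (i - 1) else v (i - 1) + \<alpha> i *\<^sub>R s i)"
        by blast
      \<comment> \<open>For \<open>s i = 0\<close> this is zero, so both branches of the algorithm
        read \<open>v i = v (i - 1) + d i\<close>.\<close>
      define d where "d i = \<alpha> i *\<^sub>R s i" for i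
      have \<xi>: "\<xi> i \<in> V i" and \<eta>: "\<eta> i \<in> V i" and s: "s i = \<eta> i - \<xi> i"
        and \<alpha>: "\<alpha> i = - E' (v (i - 1)) (s i) / (L * (norm (s i))\<^sup>2)"
        and eq: "\<And>w. w \<in> V i \<Longrightarrow> Es' i (\<eta> i) w = (Es' i (\<xi> i) - E' (v (i - 1))) w"
        if "i \<in> {1..N}" for i
        using step Q_range that by auto
      have sV: "s i \<in> V i" if "i \<in> {1..N}" for i
        using s \<xi> \<eta> V that by (simp add: subspace_diff)
      have v: "v i = v (i - 1) + d i" if "i \<in> {1..N}" for i
        using step that by (auto simp: d_def)
      have s_slope: "E' (v (i - 1)) (s i) = - L * \<alpha> i * (norm (s i))\<^sup>2" if i: "i \<in> {1..N}" for i
        using \<alpha>[OF i] L by (cases "s i = 0") (simp_all add: field_simps)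
      have slope: "E' (v (i - 1)) (d i) = - L * (norm (d i))\<^sup>2" if i: "i \<in> {1..N}" for i
        using s_slope[OF i]
        by (simp add: d_def blinfun.scaleR_right power_mult_distrib power2_eq_square[of "\<alpha> i"])
      have drop: "E (v i) \<le> E (v (i - 1)) - L / 2 * (norm (d i))\<^sup>2"
        if "i \<in> {1..N}" "v (i - 1) \<in> B" for i
        using descent_within_sublevel[OF E_deriv E_lipschitz L _ slope] that by (simp add: v B_def)
      \<comment> \<open>The descent estimate needs \<open>v (i - 1) \<in> B\<close>, so membership
        and decrease advance together along the sweep.\<close>
      have E_le: "E (v i) \<le> E a" if "i \<le> N" for i
        using that
      proof (induction i)
        case (Suc i)
        then have "v i \<in> B"
          using aB by (auto simp: B_def sublevel_def)
        moreover have "0 \<le> L / 2 * (norm (d (Suc i)))\<^sup>2"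
          using L by simp
        ultimately show ?case
          using drop[of "Suc i"] Suc by simp
      qed (simp add: v0)
      then have vB: "v i \<in> B" if "i \<le> N" for i
        using aB that by (force simp: B_def sublevel_def)
      \<comment> \<open>On \<open>V i\<close> the local equation writes
        \<open>E' (v (i - 1))\<close> as a difference of \<open>Es' i\<close> at
        \<open>\<xi> i\<close> and \<open>\<eta> i\<close>; the local Lipschitz bound then requires
        both points in the projected enlargement.\<close>
      have residual: "E' (v (i - 1)) w \<le> L * \<kappa> * norm (d i) * norm w"
        if i: "i \<in> {1..N}" and w: "w \<in> V i" for i w
      proof -
        have vB': "v (i - 1) \<in> B"
          using vB i by auto
        note corr = V[OF i] \<xi>[OF i] \<eta>[OF i] Es_convex[OF i] eq[OF i]
        have "norm (s i) \<le> sqrt \<rho>"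
          using local_correction_norm_bound[OF corr]
          by (intro correction_le[OF i vB']) (auto simp: s[OF i])
        then have "v (i - 1) + s i \<in> enlargement B (sqrt \<rho>)"
          using infdist_le[OF vB', of "v (i - 1) + s i"] by (simp add: enlargement_def dist_norm)
        \<comment> \<open>Linearity and \<open>Q i (s i) = s i\<close> exhibit
          \<open>\<eta> i\<close> as the projection of a point within \<open>norm (s i)\<close> of
          \<open>B\<close>.\<close>
        moreover have "Q i (v (i - 1) + s i) = \<eta> i"
          using linear_add[OF Q_linear[OF i]] Q_proj[OF i sV[OF i]] step i by auto
        ultimately have \<eta>B: "\<eta> i \<in> Q i ` enlargement B (sqrt \<rho>)"
          by force
        have "0 \<le> sqrt \<rho>"
          using \<open>norm (s i) \<le> sqrt \<rho>\<close> norm_ge_zero order_trans by blast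
        then have "v (i - 1) \<in> enlargement B (sqrt \<rho>)"
          using vB' by (simp add: enlargement_def)
        then have \<xi>B: "\<xi> i \<in> Q i ` enlargement B (sqrt \<rho>)"
          using step i by blast
        have "E' (v (i - 1)) w = (Es' i (\<xi> i) - Es' i (\<eta> i)) w"
          using eq[OF i w] by (simp add: blinfun.diff_left)
        also have "\<dots> \<le> dual_norm_on (V i) (Es' i (\<xi> i) - Es' i (\<eta> i)) * norm w"
          using w by (rule dual_norm_on_bound)
        also have "\<dots> \<le> Ls i * norm (s i) * norm w"
          using Es_lipschitz[OF i \<eta>B[unfolded B_def \<rho>_def] \<xi>B[unfolded B_def \<rho>_def]]
          by (intro mult_right_mono) (auto simp: s[OF i] norm_minus_commute)
        also have "\<dots> \<le> L * \<kappa> * norm (d i) * norm w"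
        proof (intro mult_right_mono)
          \<comment> \<open>The step is not too short: the local slope estimate gives
            \<open>\<alpha> i \<ge> \<mu>s i / L\<close> when \<open>s i\<close> is nonzero. Trading
            \<open>s i\<close> for \<open>d i\<close> produces the ratio
            \<open>Ls i / \<mu>s i\<close>.\<close>
          have "\<mu>s i * norm (s i) \<le> L * norm (d i)"
          proof (cases "s i = 0")
            case False
            have "\<mu>s i * (norm (s i))\<^sup>2 \<le> L * \<alpha> i * (norm (s i))\<^sup>2"
              using local_correction_slope[OF corr] s_slope[OF i] by (simp add: s[OF i])
            then have "\<mu>s i \<le> L * \<alpha> i"
              using False by simp
            also have "\<dots> \<le> L * \<bar>\<alpha> i\<bar>"
              using L by simp
            finally have "\<mu>s i * norm (s i) \<le> L * \<bar>\<alpha> i\<bar> * norm (s i)"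
              by (rule mult_right_mono) simp
            then show ?thesis
              by (simp add: d_def)
          qed (simp add: d_def)
          then have "Ls i / \<mu>s i * (\<mu>s i * norm (s i)) \<le> \<kappa> * (L * norm (d i))"
            using \<kappa>[OF i] \<open>\<kappa> \<ge> 0\<close> \<mu>s[OF i] by - (rule mult_mono, auto)
          then show "Ls i * norm (s i) \<le> L * \<kappa> * norm (d i)"
            using \<mu>s[OF i] by (simp add: mult_ac)
        qed simp
        finally show ?thesis .
      qed
      have d: "v i - v (i - 1) = d i" if "i \<in> {1..N}" for i
        using v[OF that] by simp
      have dV: "d i \<in> V i" if "i \<in> {1..N}" for i
        using sV V that by (simp add: d_def subspace_scale)
      have dual: "E' (v N) w \<le> M * sqrt (\<Sum>i=1..N. (norm (v i - v (i - 1)))\<^sup>2) * norm w" for w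
        \<comment> \<open>Expanding \<open>L * (1 + \<kappa>)\<close> matches \<open>M\<close> with
          the abstract bound for \<open>K = L * \<kappa>\<close>.\<close>
        unfolding M_def distrib_left[of L] mult_1_right add.assoc[symmetric]
      proof (rule subspace_correction_dual_bound[OF stable SCS E_lipschitz])
        show "v i \<in> sublevel E u0" if "i \<le> N" for i
          using vB[OF that] by (simp add: B_def)
        show "v i - v (i - 1) \<in> V i" if "i \<in> {1..N}" for i
          using dV[OF that] d[OF that] by simp
        show "E' (v (i - 1)) w \<le> L * \<kappa> * norm (v i - v (i - 1)) * norm w"
          if "i \<in> {1..N}" "w \<in> V i" for i w
          unfolding d[OF that(1)] using that by (rule residual)
      qed (use L \<open>\<kappa> \<ge> 0\<close> in auto)
      have "E (v N) - E u \<le> M\<^sup>2 / (M\<^sup>2 + L * \<mu>) * (E (v 0) - E u)"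
      proof (rule subspace_correction_contraction[OF E_deriv E_convex L _ dual])
        show "L / 2 * (norm (v i - v (i - 1)))\<^sup>2 \<le> E (v (i - 1)) - E (v i)"
          if "i \<in> {1..N}" for i
          using drop[OF that] vB[of "i - 1"] that unfolding d[OF that] by fastforce
      qed
      then show ?thesis
        using E_le[of N] by (simp add: v0 vN)
    qed
    have "us n \<in> B" for n
    proof (induction n)
      case 0
      then show ?case using u0B us_0 by simp
    next
      case (Suc n)
      then show ?case
        using one_step[OF Suc us_Suc] by (simp add: B_def sublevel_def)
    qed
    from one_step[OF this us_Suc] show ?thesis
      by (simp add: rate)
  qed
qed

end
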